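(* For any continuous-time birth-and-death process with generator $\mathcal L$, state space $\mathbb Z_{\ge0}$ and stationary distribution $\nu$, and any subset $K$ of the state space $\mathbb Z_{\ge0}$, the following inequality holds: $$\mathrm{Var}_{\nu_K}(f)\le C_L\sum_{k:\,k,k+1\in K}Q_K(k,k+1)\,(f(k+1)-f(k))^2\qquad\forall f\in\ell_{2,\nu_K},$$ where the constant $C_L$ is defined as $$C_L=\max_{k:\,k,k+1\in K}\ \frac{\sum_{x,y\in K:\,x\le k\le y-1}|x-y|\,\nu_K(x)\,\nu_K(y)}{Q_K(k,k+1)},$$ with $\nu_K(x)=\frac{\nu(x)}{\sum_{y\in K}\nu(y)}$ for $x\in K$ and $\nu_K(x)=0$ otherwise, and $Q_K(u,v)=\nu_K(u)\mathcal L(u,v)=\nu_K(v)\mathcal L(v,u)$ for all $u,v\in\mathbb Z_{\ge0}$.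
   Context: $\mathcal L(u,v)$ denotes the $(u,v)$ entry of the generator, i.e. the transition rate from $u$ to $v$ when $u\neq v$; for a birth-and-death process, $\mathcal L(u,v)>0$ with $u\ne v$ only if $|u-v|=1$. $\ell_{2,\nu_K}$ is the space of real functions square-integrable with respect to $\nu_K$, and $\mathrm{Var}_{\nu_K}(f)=\mathbb E_{\nu_K}[f^2]-\mathbb E_{\nu_K}[f]^2$.
   Formalization: K is taken to be an interval of integers with ν(K)>0, since the claim fails for K={0,1,3} and f the indicator of 3; Q_K(k,k+1) is assumed nonzero for k,k+1 in K so that C_L is defined; the max is a supremum in [0,∞]; the symmetry of Q_K holds only for u,v in K. *)

theory Defs
  imports "HOL-Probability.Probability"
begin

definition birth_death_generator :: "(nat \<Rightarrow> nat \<Rightarrow> real) \<Rightarrow> bool" where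
  "birth_death_generator L \<longleftrightarrow>
     (\<forall>u v. u \<noteq> v \<longrightarrow> 0 \<le> L u v) \<and>
     (\<forall>u v. u \<noteq> v \<and> 0 < L u v \<longrightarrow> \<bar>int u - int v\<bar> = 1) \<and>
     (\<forall>u. (L u has_sum 0) UNIV)"

definition stationary_distribution :: "(nat \<Rightarrow> nat \<Rightarrow> real) \<Rightarrow> nat pmf \<Rightarrow> bool" where
  "stationary_distribution L \<nu> \<longleftrightarrow> (\<forall>v. ((\<lambda>u. pmf \<nu> u * L u v) has_sum 0) UNIV)"

text \<open>The restriction of \<open>\<nu>\<close> to \<open>K\<close>, normalised to a probability distribution, is
  \<open>cond_pmf \<nu> K\<close>; it is meaningful only if \<open>set_pmf \<nu> \<inter> K \<noteq> {}\<close>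
  (see \<open>cond_pmf_eq_normalised\<close> below).\<close>

definition ell2 :: "nat pmf \<Rightarrow> (nat \<Rightarrow> real) set" where
  "ell2 \<mu> = {f. integrable (measure_pmf \<mu>) (\<lambda>x. (f x)\<^sup>2)}"

definition Var :: "nat pmf \<Rightarrow> (nat \<Rightarrow> real) \<Rightarrow> real" where
  "Var \<mu> f = measure_pmf.expectation \<mu> (\<lambda>x. (f x)\<^sup>2) - (measure_pmf.expectation \<mu> f)\<^sup>2"

definition QK :: "(nat \<Rightarrow> nat \<Rightarrow> real) \<Rightarrow> nat pmf \<Rightarrow> nat set \<Rightarrow> nat \<Rightarrow> nat \<Rightarrow> real" where
  "QK L \<nu> K u v = pmf (cond_pmf \<nu> K) u * L u v"

definition edges :: "nat set \<Rightarrow> nat set" where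
  "edges K = {k. k \<in> K \<and> k + 1 \<in> K}"

text \<open>For infinite \<open>K\<close> neither the inner sum nor the supremum need be finite, so the constant lives
  in \<open>ennreal\<close>. The condition \<open>k \<le> y - 1\<close> is written \<open>k + 1 \<le> y\<close> because subtraction on
  \<open>nat\<close> truncates.\<close>

definition CL :: "(nat \<Rightarrow> nat \<Rightarrow> real) \<Rightarrow> nat pmf \<Rightarrow> nat set \<Rightarrow> ennreal" where
  "CL L \<nu> K =
     (SUP k\<in>edges K.
        (\<Sum>\<^sub>\<infinity>(x, y)\<in>{(x, y). x \<in> K \<and> y \<in> K \<and> x \<le> k \<and> k + 1 \<le> y}.
           ennreal (\<bar>real x - real y\<bar> * pmf (cond_pmf \<nu> K) x * pmf (cond_pmf \<nu> K) y))
        / ennreal (QK L \<nu> K k (k + 1)))"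

definition dirichlet_form ::
    "(nat \<Rightarrow> nat \<Rightarrow> real) \<Rightarrow> nat pmf \<Rightarrow> nat set \<Rightarrow> (nat \<Rightarrow> real) \<Rightarrow> ennreal" where
  "dirichlet_form L \<nu> K f =
     (\<Sum>\<^sub>\<infinity>k\<in>edges K. ennreal (QK L \<nu> K k (k + 1) * (f (k + 1) - f k)\<^sup>2))"

lemma cond_pmf_eq_normalised:
  assumes "set_pmf \<nu> \<inter> K \<noteq> {}"
  shows "pmf (cond_pmf \<nu> K) x = (if x \<in> K then pmf \<nu> x / (\<Sum>\<^sub>\<infinity>y\<in>K. pmf \<nu> y) else 0)"
proof -
  have "(\<Sum>\<^sub>\<infinity>y\<in>K. pmf \<nu> y) = measure_pmf.prob \<nu> K"
    by (simp add: measure_pmf_conv_infsetsum infsetsum_infsum pmf_abs_summable)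
  thus ?thesis using assms by (simp add: pmf_cond)
qed

text \<open>Stationarity forces detailed balance for a birth-and-death generator. Hence \<open>QK\<close> is symmetric
  on \<open>K\<close>; it is not symmetric for a pair with only one element in \<open>K\<close>.\<close>

lemma detailed_balance_Suc:
  assumes L: "birth_death_generator L" and st: "stationary_distribution L \<nu>"
  shows "pmf \<nu> n * L n (Suc n) = pmf \<nu> (Suc n) * L (Suc n) n"
proof -
  have far: "L u v = 0" if "\<bar>int u - int v\<bar> > 1" for u v
    using L that unfolding birth_death_generator_def by (smt (verit))
  have row: "(\<Sum>v\<le>Suc u. L u v) = 0" for u
  proof -
    have "(L u has_sum (\<Sum>v\<le>Suc u. L u v)) UNIV"
      by (rule has_sum_finite_neutralI[of "{..Suc u}"]) (auto intro!: far)
    thus ?thesis using L has_sum_unique unfolding birth_death_generator_def by blast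
  qed
  have col: "(\<Sum>u\<le>Suc v. pmf \<nu> u * L u v) = 0" for v
  proof -
    have "((\<lambda>u. pmf \<nu> u * L u v) has_sum (\<Sum>u\<le>Suc v. pmf \<nu> u * L u v)) UNIV"
      by (rule has_sum_finite_neutralI[of "{..Suc v}"]) (auto intro!: far)
    thus ?thesis using st has_sum_unique unfolding stationary_distribution_def by blast
  qed
  show ?thesis
  proof (induction n)
    case 0
    have "L 0 0 = - L 0 1" using row[of 0] by simp
    thus ?case using col[of 0] by simp
  next
    case (Suc n)
    have r: "L (Suc n) n + L (Suc n) (Suc n) + L (Suc n) (Suc (Suc n)) = 0"
    proof -
      have "(\<Sum>v<n. L (Suc n) v) = 0" by (rule sum.neutral) (auto intro!: far)
      thus ?thesis using row[of "Suc n"]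
        by (simp flip: lessThan_Suc_atMost)
    qed
    have c: "pmf \<nu> n * L n (Suc n) + pmf \<nu> (Suc n) * L (Suc n) (Suc n)
        + pmf \<nu> (Suc (Suc n)) * L (Suc (Suc n)) (Suc n) = 0"
    proof -
      have "(\<Sum>u<n. pmf \<nu> u * L u (Suc n)) = 0" by (rule sum.neutral) (auto intro!: far)
      thus ?thesis using col[of "Suc n"]
        by (simp flip: lessThan_Suc_atMost)
    qed
    have "L (Suc n) (Suc (Suc n)) = - L (Suc n) n - L (Suc n) (Suc n)" using r by linarith
    hence "pmf \<nu> (Suc n) * L (Suc n) (Suc (Suc n)) =
        - (pmf \<nu> (Suc n) * L (Suc n) n) - pmf \<nu> (Suc n) * L (Suc n) (Suc n)"
      by (simp add: right_diff_distrib)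
    thus ?case using c Suc.IH by linarith
  qed
qed

lemma detailed_balance:
  assumes "birth_death_generator L" "stationary_distribution L \<nu>"
  shows "pmf \<nu> u * L u v = pmf \<nu> v * L v u"
proof -
  consider "u = v" | "v = Suc u" | "u = Suc v" | "\<bar>int u - int v\<bar> > 1" by linarith
  thus ?thesis
  proof cases
    case 4
    hence "L u v = 0" "L v u = 0"
      using assms(1) unfolding birth_death_generator_def by (smt (verit))+
    thus ?thesis by simp
  qed (use detailed_balance_Suc[OF assms] in auto)
qed

lemma QK_sym:
  assumes "birth_death_generator L" "stationary_distribution L \<nu>" "set_pmf \<nu> \<inter> K \<noteq> {}"
    and "u \<in> K" "v \<in> K"
  shows "QK L \<nu> K u v = pmf (cond_pmf \<nu> K) v * L v u"
  using detailed_balance[OF assms(1,2), of u v] assms(3-5)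
  by (simp add: QK_def pmf_cond)

end

theory Submission
  imports Defs
begin

text \<open>
  The variance is the double sum of \<open>(f y - f x)\<^sup>2\<close> over \<open>x < y\<close>, weighted with the product measure.
  Telescoping along the path from \<open>x\<close> to \<open>y\<close>, Cauchy-Schwarz bounds the square by \<open>y - x\<close> times the
  sum of the squared increments on the edges of the path. Exchanging the sums collects at each edge
  \<open>k\<close> the numerator of \<open>CL\<close>. All of this takes place in \<open>ennreal\<close>, so that no summability is needed.
\<close>

text \<open>Bridge from the sums of \<open>CL\<close> and \<open>dirichlet_form\<close> to
  integrals, where Tonelli is available. Enumerating \<open>A\<close> by naturals turns both sides
  into the same series; \<open>g\<close> is padded with zeros off the range of the
  enumeration.\<close>

lemma infsum_ennreal_eq_nn_integral:
  fixes f :: "'a \<Rightarrow> ennreal"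
  assumes "countable A"
  shows "infsum f A = (\<integral>\<^sup>+x. f x \<partial>count_space A)"
proof -
  define g where "g = (\<lambda>n. f (from_nat_into A n) * indicator (to_nat_on A ` A) n)"
  have inj: "inj_on (to_nat_on A) A" using assms by (rule inj_on_to_nat_on)
  have "(\<integral>\<^sup>+x. f x \<partial>count_space A) = (\<integral>\<^sup>+x. f (from_nat_into A (to_nat_on A x)) \<partial>count_space A)"
    using assms by (intro nn_integral_cong) simp
  also have "\<dots> = (\<integral>\<^sup>+n. f (from_nat_into A n) \<partial>count_space (to_nat_on A ` A))"
    by (rule nn_integral_bij_count_space) (use inj in \<open>simp add: bij_betw_def\<close>)
  also have "\<dots> = (\<integral>\<^sup>+n. g n \<partial>count_space UNIV)"
    unfolding g_def by (subst nn_integral_count_space_indicator) simp_all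
  also have "\<dots> = suminf g"
    by (rule nn_integral_count_space_nat)
  also have "\<dots> = infsum g UNIV"
    by (rule sums_unique[symmetric], rule has_sum_imp_sums, rule has_sum_infsum)
      (simp add: nonneg_summable_on_complete)
  also have "\<dots> = infsum (\<lambda>n. f (from_nat_into A n)) (to_nat_on A ` A)"
    unfolding g_def by (intro infsum_cong_neutral) auto
  also have "\<dots> = infsum (\<lambda>x. f (from_nat_into A (to_nat_on A x))) A"
    by (subst infsum_reindex[OF inj]) (simp add: o_def)
  also have "\<dots> = infsum f A"
    using assms by (intro infsum_cong) simp
  finally show ?thesis by simp
qed

text \<open>With the first coordinate frozen at \<open>f x = a\<close>, the inner integral is the
  quadratic \<open>s - 2 * a * m + a\<^sup>2\<close>; integrating it over \<open>x\<close> gives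
  twice \<open>s - m\<^sup>2\<close>. Square integrability makes every term finite.\<close>

lemma Var_eq_nn_integral_pair:
  assumes "f \<in> ell2 \<mu>"
  shows "2 * ennreal (Var \<mu> f) = (\<integral>\<^sup>+z. ennreal ((f (snd z) - f (fst z))\<^sup>2) \<partial>pair_pmf \<mu> \<mu>)"
proof -
  have sq: "integrable \<mu> (\<lambda>x. (f x)\<^sup>2)"
    using assms by (simp add: ell2_def)
  have int: "integrable \<mu> f"
    by (rule measure_pmf.square_integrable_imp_integrable[OF _ sq]) simp
  define m s where "m = measure_pmf.expectation \<mu> f" and "s = measure_pmf.expectation \<mu> (\<lambda>x. (f x)\<^sup>2)"
  have dev: "integrable \<mu> (\<lambda>y. (f y - a)\<^sup>2)" for a
    using sq int by (simp add: power2_diff)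
  have val: "(\<integral>y. (f y - a)\<^sup>2 \<partial>\<mu>) = s - 2 * a * m + a\<^sup>2" for a
    using sq int by (simp add: power2_diff m_def s_def)
  have inner: "(\<integral>\<^sup>+y. ennreal ((f y - a)\<^sup>2) \<partial>\<mu>) = ennreal (s - 2 * a * m + a\<^sup>2)" for a
    unfolding val[symmetric] using dev by (intro nn_integral_eq_integral) simp_all
  have nonneg: "0 \<le> s - 2 * a * m + a\<^sup>2" for a
    unfolding val[symmetric] by (rule integral_nonneg_AE) simp
  have "(\<integral>\<^sup>+z. ennreal ((f (snd z) - f (fst z))\<^sup>2) \<partial>pair_pmf \<mu> \<mu>)
      = (\<integral>\<^sup>+x. ennreal (s - 2 * f x * m + (f x)\<^sup>2) \<partial>\<mu>)"
    by (simp add: nn_integral_pair_pmf' inner)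
  also have "\<dots> = ennreal (\<integral>x. s - 2 * f x * m + (f x)\<^sup>2 \<partial>\<mu>)"
    using sq int nonneg by (intro nn_integral_eq_integral) auto
  also have "(\<integral>x. s - 2 * f x * m + (f x)\<^sup>2 \<partial>\<mu>) = 2 * Var \<mu> f"
    using sq int by (simp add: Var_def m_def s_def power2_eq_square)
  finally show ?thesis
    by (simp add: ennreal_mult')
qed

text \<open>The diagonal contributes zero and swapping the coordinates preserves the product
  measure, so the halves above and below the diagonal are equal; the factor 2 then cancels.\<close>

lemma Var_eq_nn_integral_less:
  assumes "f \<in> ell2 \<mu>"
  shows "ennreal (Var \<mu> f) =
    (\<integral>\<^sup>+z. (if fst z < snd z then ennreal ((f (snd z) - f (fst z))\<^sup>2) else 0) \<partial>pair_pmf \<mu> \<mu>)"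
    (is "_ = ?I")
proof -
  let ?F = "\<lambda>z. ennreal ((f (snd z) - f (fst z))\<^sup>2)"
  have "(\<integral>\<^sup>+z. ?F z \<partial>pair_pmf \<mu> \<mu>) =
      (\<integral>\<^sup>+z. (if fst z < snd z then ?F z else 0) + (if snd z < fst z then ?F z else 0) \<partial>pair_pmf \<mu> \<mu>)"
    by (intro nn_integral_cong) (auto simp: not_less le_less)
  also have "\<dots> = ?I + (\<integral>\<^sup>+z. (if snd z < fst z then ?F z else 0) \<partial>pair_pmf \<mu> \<mu>)"
    by (rule nn_integral_add) simp_all
  also have "(\<integral>\<^sup>+z. (if snd z < fst z then ?F z else 0) \<partial>pair_pmf \<mu> \<mu>) = ?I"
    by (subst pair_commute_pmf)
      (simp add: case_prod_beta power2_commute cong: if_cong)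
  finally have "2 * ennreal (Var \<mu> f) = 2 * ?I"
    using Var_eq_nn_integral_pair[OF assms] by (simp add: mult_2)
  thus ?thesis
    by (simp add: ennreal_mult_cancel_left)
qed

text \<open>The Cauchy-Schwarz factor is the number \<open>y - x\<close> of increments; it is
  written as an absolute value inside the sum to match the weight in \<open>CL\<close>.\<close>

lemma square_diff_le_sum_increments:
  fixes f :: "nat \<Rightarrow> real"
  assumes "x \<le> y"
  shows "(f y - f x)\<^sup>2 \<le> (\<Sum>k=x..<y. \<bar>real x - real y\<bar> * (f (k + 1) - f k)\<^sup>2)"
proof -
  have "f y - f x = (\<Sum>k=x..<y. f (k + 1) - f k)"
    using assms by (simp add: sum_Suc_diff')
  thus ?thesis
    using sum_squared_le_sum_of_squares[of "\<lambda>k. f (k + 1) - f k" "{x..<y}"] assms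
    by (simp add: sum_distrib_left[symmetric] of_nat_diff mult.commute)
qed

theorem lemma6:
  fixes L :: "nat \<Rightarrow> nat \<Rightarrow> real" and \<nu> :: "nat pmf" and K :: "nat set"
  assumes "birth_death_generator L"
    and "stationary_distribution L \<nu>"
    and "set_pmf \<nu> \<inter> K \<noteq> {}"
    and "\<And>x y. x \<in> K \<Longrightarrow> y \<in> K \<Longrightarrow> {x..y} \<subseteq> K"
    and "\<And>k. k \<in> edges K \<Longrightarrow> QK L \<nu> K k (k + 1) \<noteq> 0"
  shows "\<forall>f \<in> ell2 (cond_pmf \<nu> K).
           ennreal (Var (cond_pmf \<nu> K) f) \<le> CL L \<nu> K * dirichlet_form L \<nu> K f"
proof
  fix f assume f: "f \<in> ell2 (cond_pmf \<nu> K)"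
  define \<mu> where "\<mu> = cond_pmf \<nu> K"
  define d where "d k = ennreal ((f (k + 1) - f k)\<^sup>2)" for k
  define q where "q k = ennreal (QK L \<nu> K k (k + 1))" for k
  define T where "T k = {(x, y). x \<in> K \<and> y \<in> K \<and> x \<le> k \<and> k + 1 \<le> y}" for k
  define w where "w z = ennreal \<bar>real (fst z) - real (snd z)\<bar>" for z
  define S where "S k = (\<Sum>\<^sub>\<infinity>(x, y)\<in>T k. ennreal (\<bar>real x - real y\<bar> * pmf \<mu> x * pmf \<mu> y))" for k
  have supp: "set_pmf (pair_pmf \<mu> \<mu>) \<subseteq> K \<times> K"
    using assms(3) by (auto simp: \<mu>_def)
  \<comment> \<open>The numerator of \<open>CL\<close> at \<open>k\<close> is the integral over the
    product measure of the path length, restricted to the pairs whose path crosses the edge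
    \<open>k\<close>.\<close>
  have S_eq: "S k = (\<integral>\<^sup>+z. w z * indicator (T k) z \<partial>pair_pmf \<mu> \<mu>)" for k
  proof -
    have "S k = (\<integral>\<^sup>+z. ennreal (pmf (pair_pmf \<mu> \<mu>) z) * (w z * indicator (T k) z) \<partial>count_space UNIV)"
      unfolding S_def
      by (subst infsum_ennreal_eq_nn_integral, simp,
          subst nn_integral_count_space_indicator, simp,
          intro nn_integral_cong)
        (auto simp: w_def pmf_pair ennreal_mult' mult_ac split: split_indicator)
    thus ?thesis by (simp add: nn_integral_measure_pmf)
  qed
  have S_le: "S k \<le> CL L \<nu> K * q k" if k: "k \<in> edges K" for k
  proof -
    \<comment> \<open>Cancelling \<open>q k\<close> in \<open>ennreal\<close> requires it to be
      neither 0 nor \<top>. As \<open>ennreal\<close> sends negative reals to 0, a nonzero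
      \<open>QK\<close> does not suffice: its sign matters too.\<close>
    have "0 \<le> QK L \<nu> K k (k + 1)"
      using assms(1) by (auto simp: QK_def birth_death_generator_def)
    hence "q k \<noteq> 0" "q k \<noteq> \<top>"
      using assms(5)[OF k] by (auto simp: q_def ennreal_eq_0_iff)
    hence "S k = S k / q k * q k"
      by (simp add: ennreal_divide_times ennreal_divide_self less_top)
    also have "S k / q k \<le> CL L \<nu> K"
      unfolding CL_def S_def q_def T_def \<mu>_def using k by (intro SUP_upper2[of k]) auto
    finally show ?thesis by (simp add: mult_right_mono)
  qed
  have pointwise: "(if fst z < snd z then ennreal ((f (snd z) - f (fst z))\<^sup>2) else 0)
      \<le> (\<integral>\<^sup>+k. d k * (w z * indicator (T k) z) \<partial>count_space (edges K))"
    if z: "z \<in> set_pmf (pair_pmf \<mu> \<mu>)" for z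
  proof (cases "fst z < snd z")
    case True
    obtain x y where [simp]: "z = (x, y)" by (cases z)
    have xy: "x \<in> K" "y \<in> K" "x < y" using supp z True by auto
    \<comment> \<open>Since \<open>K\<close> has no gaps, the whole path from \<open>x\<close> to
      \<open>y\<close> stays in \<open>K\<close>, so each of its edges occurs in the Dirichlet
      form.\<close>
    have E: "{x..<y} \<subseteq> edges K"
    proof
      fix k assume "k \<in> {x..<y}"
      hence "k \<in> {x..y}" "k + 1 \<in> {x..y}" by auto
      thus "k \<in> edges K" using assms(4)[OF xy(1,2)] by (auto simp: edges_def)
    qed
    have "ennreal ((f y - f x)\<^sup>2) \<le> ennreal (\<Sum>k=x..<y. \<bar>real x - real y\<bar> * (f (k + 1) - f k)\<^sup>2)"
      using square_diff_le_sum_increments[of x y f] xy(3) by (intro ennreal_leI) simp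
    \<comment> \<open>For \<open>x \<le> k < y\<close> the pair lies in \<open>T k\<close>, so the
      indicator equals 1.\<close>
    also have "\<dots> = (\<Sum>k=x..<y. d k * (w z * indicator (T k) z))"
      using xy by (subst sum_ennreal[symmetric])
        (auto simp: d_def w_def T_def ennreal_mult' mult_ac intro!: sum.cong)
    also have "\<dots> = (\<integral>\<^sup>+k. d k * (w z * indicator (T k) z) \<partial>count_space {x..<y})"
      by (simp add: nn_integral_count_space_finite)
    also have "\<dots> \<le> (\<integral>\<^sup>+k. d k * (w z * indicator (T k) z) \<partial>count_space (edges K))"
      using E by (auto simp: nn_integral_count_space_indicator intro!: nn_integral_mono split: split_indicator)
    finally show ?thesis using True by simp
  qed simp
  \<comment> \<open>The pointwise bound is known only on the support, hence the almost-everywhere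
    form of monotonicity.\<close>
  have "ennreal (Var \<mu> f) \<le>
      (\<integral>\<^sup>+z. (\<integral>\<^sup>+k. d k * (w z * indicator (T k) z) \<partial>count_space (edges K)) \<partial>pair_pmf \<mu> \<mu>)"
    unfolding Var_eq_nn_integral_less[OF f[folded \<mu>_def]]
    by (intro nn_integral_mono_AE) (simp add: AE_measure_pmf_iff pointwise)
  \<comment> \<open>Tonelli over the countable set of edges; \<open>d k\<close> is constant in
    \<open>z\<close>, so the inner integral becomes \<open>d k * S k\<close>.\<close>
  also have "\<dots> = (\<integral>\<^sup>+k. (\<integral>\<^sup>+z. d k * (w z * indicator (T k) z) \<partial>pair_pmf \<mu> \<mu>) \<partial>count_space (edges K))"
    by (rule nn_integral_count_space_nn_integral) simp_all
  also have "\<dots> = (\<integral>\<^sup>+k. d k * S k \<partial>count_space (edges K))"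
    by (simp add: nn_integral_cmult S_eq)
  also have "\<dots> \<le> (\<integral>\<^sup>+k. CL L \<nu> K * (q k * d k) \<partial>count_space (edges K))"
  proof (intro nn_integral_mono)
    fix k assume "k \<in> space (count_space (edges K))"
    hence "d k * S k \<le> d k * (CL L \<nu> K * q k)"
      by (intro mult_left_mono S_le) simp_all
    thus "d k * S k \<le> CL L \<nu> K * (q k * d k)" by (simp add: mult_ac)
  qed
  also have "\<dots> = CL L \<nu> K * dirichlet_form L \<nu> K f"
    by (simp add: nn_integral_cmult dirichlet_form_def infsum_ennreal_eq_nn_integral
        q_def d_def ennreal_mult'')
  finally show "ennreal (Var (cond_pmf \<nu> K) f) \<le> CL L \<nu> K * dirichlet_form L \<nu> K f"
    by (simp add: \<mu>_def)
qed

end
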